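(* Let $X$ be a topological vector space, let $V\subset X$ be a closed convex cone, and let $A,B,C\in\mathcal{C}_V(X)$. Then the inclusion $A\dot{+}B\subset B\dot{+}C$ implies $A\subset C$.
   Context: Topological vector spaces are real. $\mathcal{C}(X)$ is the family of all nonempty closed convex subsets of $X$, and $\mathcal{B}(X)$ is the family of all nonempty bounded closed convex subsets of $X$. The addition is $A\dot{+}B=\operatorname{cl}\{a+b:a\in A,b\in B\}$. $\mathcal{C}_V(X)=\{A\in\mathcal{C}(X): A\subset V\dot{+}D \text{ and } V\subset A\dot{+}D\text{ for some }D\in\mathcal{B}(X)\}$. *)

theory Defs
  imports "HOL-Analysis.Analysis"
begin

text \<open>Real topological vector spaces. Neither the Hausdorff property nor local convexity
  is assumed.\<close>

class real_tvs = real_vector + topological_ab_group_add +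
  assumes tendsto_scaleR_Pair:
    "LIM x (nhds r \<times>\<^sub>F nhds a). fst x *\<^sub>R snd x :> nhds (r *\<^sub>R a)"

instance real_normed_vector < real_tvs
proof
  fix r :: real and a :: 'a
  show "LIM x (nhds r \<times>\<^sub>F nhds a). fst x *\<^sub>R snd x :> nhds (r *\<^sub>R a)"
    by (intro tendsto_scaleR filterlim_fst filterlim_snd)
qed

text \<open>The library's \<open>bounded\<close> is metric; in a topological vector space a set is bounded if it is
  absorbed by every neighbourhood of the origin. The two agree on normed spaces, see
  \<open>tvs_bounded_iff_bounded\<close>.\<close>

definition tvs_bounded :: "'a::real_tvs set \<Rightarrow> bool" where
  "tvs_bounded S \<longleftrightarrow>
     (\<forall>U. open U \<and> 0 \<in> U \<longrightarrow> (\<exists>s>0. \<forall>t>s. S \<subseteq> (\<lambda>x. t *\<^sub>R x) ` U))"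

lemma tvs_bounded_iff_bounded:
  fixes S :: "'a::real_normed_vector set"
  shows "tvs_bounded S \<longleftrightarrow> bounded S"
proof
  assume "tvs_bounded S"
  then have "\<exists>s>0. \<forall>t>s. S \<subseteq> (\<lambda>x. t *\<^sub>R x) ` ball 0 1"
    unfolding tvs_bounded_def by (metis centre_in_ball open_ball zero_less_one)
  then obtain s where s: "s > 0" "\<forall>t>s. S \<subseteq> (\<lambda>x. t *\<^sub>R x) ` ball 0 1"
    by blast
  then have "S \<subseteq> (\<lambda>x. (s + 1) *\<^sub>R x) ` ball 0 1" by simp
  then show "bounded S"
    by (rule bounded_subset[rotated]) (intro bounded_scaling bounded_ball)
next
  assume "bounded S"
  then obtain b where b: "b > 0" "\<And>x. x \<in> S \<Longrightarrow> norm x \<le> b"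
    by (metis bounded_pos)
  show "tvs_bounded S"
    unfolding tvs_bounded_def
  proof (intro allI impI)
    fix U :: "'a set" assume "open U \<and> 0 \<in> U"
    then obtain e where e: "e > 0" "ball 0 e \<subseteq> U"
      by (meson open_contains_ball)
    have "S \<subseteq> (\<lambda>x. t *\<^sub>R x) ` U" if t: "t > b / e" for t
    proof
      fix x assume x: "x \<in> S"
      have t0: "t > 0" using t b e by (meson divide_pos_pos less_trans)
      have "b < t * e" using t e by (simp add: field_simps)
      then have "norm x < t * e" using b(2)[OF x] by simp
      then have "inverse t *\<^sub>R x \<in> ball 0 e" using t0 by (simp add: field_simps)
      then have "inverse t *\<^sub>R x \<in> U" using e by blast
      moreover have "x = t *\<^sub>R (inverse t *\<^sub>R x)" using t0 by simp
      ultimately show "x \<in> (\<lambda>x. t *\<^sub>R x) ` U" by blast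
    qed
    then show "\<exists>s>0. \<forall>t>s. S \<subseteq> (\<lambda>x. t *\<^sub>R x) ` U"
      using b e by (intro exI[of _ "b / e"]) auto
  qed
qed

definition closed_convex_sets :: "'a::real_tvs set set" where
  "closed_convex_sets = {A. A \<noteq> {} \<and> closed A \<and> convex A}"

definition bounded_closed_convex_sets :: "'a::real_tvs set set" where
  "bounded_closed_convex_sets = {A. A \<noteq> {} \<and> tvs_bounded A \<and> closed A \<and> convex A}"

definition closed_sum :: "'a::real_tvs set \<Rightarrow> 'a set \<Rightarrow> 'a set" (infixl "\<oplus>\<^sub>c" 65) where
  "A \<oplus>\<^sub>c B = closure {a + b | a b. a \<in> A \<and> b \<in> B}"

definition closed_convex_sets_near :: "'a::real_tvs set \<Rightarrow> 'a set set" where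
  "closed_convex_sets_near V =
     {A \<in> closed_convex_sets. \<exists>D \<in> bounded_closed_convex_sets. A \<subseteq> V \<oplus>\<^sub>c D \<and> V \<subseteq> A \<oplus>\<^sub>c D}"

end

theory Submission
  imports Defs
begin

text \<open>
  This is Radstrom's cancellation argument. Fix \<open>a \<in> A\<close> and \<open>b \<in> B\<close>. Using \<open>a + B \<subseteq> B \<oplus>\<^sub>c C\<close>
  repeatedly, and convexity of \<open>C\<close> to collect the summands from \<open>C\<close>, gives
  \<open>n a + b \<in> B \<oplus>\<^sub>c n C\<close>, that is, \<open>a + b / n \<in> B / n \<oplus>\<^sub>c C\<close>, for every \<open>n > 0\<close>.

  For bounded \<open>B\<close> one would let \<open>n\<close> tend to infinity at this point. Here \<open>B\<close> is only within a
  bounded set \<open>D\<close> of the cone \<open>V\<close>, so \<open>B / n\<close> lies within \<open>D / n\<close> of \<open>V\<close>. The part in \<open>V\<close> does no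
  harm: since \<open>V\<close> lies within a bounded set of \<open>C\<close>, every element of \<open>V\<close> is a recession direction
  of \<open>C\<close>, and \<open>C + V \<subseteq> C\<close> (\<open>cone_directions_recede\<close>). Hence \<open>a + b / n \<in> C \<oplus>\<^sub>c D / n\<close> for
  every \<open>n > 0\<close>, and the limit gives \<open>a \<in> C\<close>.

  Both the last step and the recession property are instances of a single limit argument,
  \<open>limit_mem_closed\<close>, which uses that \<open>D / n\<close> shrinks into every neighbourhood of the origin.
  It works with neighbourhoods alone, because a general topological vector space may have too
  few continuous functionals for a separation argument.
\<close>

lemma tendsto_scaleR_tvs:
  fixes g :: "'b \<Rightarrow> 'a::real_tvs"
  assumes "(f \<longlongrightarrow> r) F" and "(g \<longlongrightarrow> a) F"
  shows "((\<lambda>x. f x *\<^sub>R g x) \<longlongrightarrow> r *\<^sub>R a) F"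
  using filterlim_compose[OF tendsto_scaleR_Pair filterlim_Pair[OF assms]] by simp

lemma continuous_on_scaleR_tvs:
  fixes g :: "'b::topological_space \<Rightarrow> 'a::real_tvs"
  assumes "continuous_on S g"
  shows "continuous_on S (\<lambda>x. r *\<^sub>R g x)"
  using assms unfolding continuous_on_def by (auto intro: tendsto_scaleR_tvs)

lemma add_mem_closed_sum: "a \<in> A \<Longrightarrow> b \<in> B \<Longrightarrow> a + b \<in> A \<oplus>\<^sub>c B"
  unfolding closed_sum_def by (intro subsetD[OF closure_subset]) blast

lemma closed_closed_sum: "closed (A \<oplus>\<^sub>c B)"
  unfolding closed_sum_def by simp

text \<open>All reasoning about closed sums goes through this rule: a closed condition, pulled back
  along a continuous map, need only be checked on genuine sums. It takes the place of
  associativity and scaling laws for \<open>\<oplus>\<^sub>c\<close>.\<close>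

lemma closed_sum_image_mem_closed:
  fixes A B :: "'a::real_tvs set" and f :: "'a \<Rightarrow> 'b::topological_space"
  assumes "x \<in> A \<oplus>\<^sub>c B" and "continuous_on UNIV f" and "closed T"
    and "\<And>a b. a \<in> A \<Longrightarrow> b \<in> B \<Longrightarrow> f (a + b) \<in> T"
  shows "f x \<in> T"
proof -
  have "f ` closure {a + b | a b. a \<in> A \<and> b \<in> B} \<subseteq> T"
    using assms(2-4) by (intro image_closure_subset) (auto intro: continuous_on_subset)
  then show ?thesis using assms(1) unfolding closed_sum_def by blast
qed

text \<open>If \<open>a\<close> were outside \<open>C\<close>, then so would be all \<open>a + x - y - z\<close> with \<open>x\<close>, \<open>y\<close>, \<open>z\<close> close to
  the origin. But for large \<open>n\<close> some point of \<open>C\<close> has this form, with \<open>x = b / n\<close>, \<open>y \<in> D / n\<close>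
  and \<open>z\<close> the error committed in passing to the closure.\<close>

lemma limit_mem_closed:
  fixes C D :: "'a::real_tvs set"
  assumes "closed C" and "tvs_bounded D"
    and approx: "\<And>n::nat. n > 0 \<Longrightarrow>
      a + (1 / real n) *\<^sub>R b \<in> C \<oplus>\<^sub>c (\<lambda>d. (1 / real n) *\<^sub>R d) ` D"
  shows "a \<in> C"
proof (rule ccontr)
  assume "a \<notin> C"
  define g where "g = (\<lambda>(x, y, z). a + x - y - z)"
  let ?F = "nhds (0::'a) \<times>\<^sub>F (nhds (0::'a) \<times>\<^sub>F nhds (0::'a))"
  have fst3: "LIM p ?F. fst p :> nhds 0"
    by (rule filterlim_fst)
  have snd3: "LIM p ?F. fst (snd p) :> nhds 0" "LIM p ?F. snd (snd p) :> nhds 0"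
    by (rule filterlim_compose[OF filterlim_fst filterlim_snd],
        rule filterlim_compose[OF filterlim_snd filterlim_snd])
  have "((\<lambda>p. a + fst p - fst (snd p) - snd (snd p)) \<longlongrightarrow> a + 0 - 0 - 0) ?F"
    by (intro tendsto_diff tendsto_add tendsto_const fst3 snd3)
  then have "(g \<longlongrightarrow> a) ?F"
    by (simp add: g_def case_prod_unfold)
  moreover have "open (- C)" and "a \<in> - C"
    using \<open>closed C\<close> \<open>a \<notin> C\<close> by auto
  ultimately have "eventually (\<lambda>p. g p \<in> - C) ?F"
    by (rule topological_tendstoD)
  then obtain P S where P: "eventually P (nhds 0)"
    and S: "eventually S (nhds 0 \<times>\<^sub>F nhds 0)" "\<And>x p. P x \<Longrightarrow> S p \<Longrightarrow> g (x, p) \<in> - C"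
    unfolding eventually_prod_filter[where F = "nhds 0" and G = "nhds 0 \<times>\<^sub>F nhds 0"] by blast
  from S(1) obtain Q R where QR: "eventually Q (nhds 0)" "eventually R (nhds 0)"
    "\<And>y z. Q y \<Longrightarrow> R z \<Longrightarrow> S (y, z)"
    unfolding eventually_prod_filter by blast
  have PQR: "a + x - y - z \<notin> C" if "P x" "Q y" "R z" for x y z
    using S(2)[OF \<open>P x\<close> QR(3)[OF \<open>Q y\<close> \<open>R z\<close>]] by (simp add: g_def)
  from P QR(1,2)
  have "eventually (\<lambda>x. P x \<and> Q x \<and> R x) (nhds 0)"
    by (intro eventually_conj)
  then obtain W where W: "open W" "0 \<in> W" and PW: "\<And>x. x \<in> W \<Longrightarrow> P x \<and> Q x \<and> R x"
    unfolding eventually_nhds by blast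
  have "((\<lambda>n. (1 / real n) *\<^sub>R b) \<longlongrightarrow> 0 *\<^sub>R b) sequentially"
    by (intro tendsto_scaleR_tvs tendsto_const lim_1_over_n)
  then have b_small: "eventually (\<lambda>n. (1 / real n) *\<^sub>R b \<in> W) sequentially"
    using W by (auto dest: topological_tendstoD)
  obtain s where s: "s > 0" "\<And>t. t > s \<Longrightarrow> D \<subseteq> (\<lambda>x. t *\<^sub>R x) ` W"
    using \<open>tvs_bounded D\<close> W unfolding tvs_bounded_def by blast
  have "eventually (\<lambda>n. real n > s) sequentially"
    using filterlim_real_sequentially by (auto simp: filterlim_at_top_dense)
  with b_small have "eventually (\<lambda>n. (1 / real n) *\<^sub>R b \<in> W \<and> real n > s) sequentially"
    by (rule eventually_conj)
  then obtain n :: nat where n: "(1 / real n) *\<^sub>R b \<in> W" "real n > s"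
    using eventually_happens'[OF sequentially_bot] by blast
  have "n > 0"
    using n(2) s(1) by (cases n) auto
  have d_small: "(1 / real n) *\<^sub>R d \<in> W" if "d \<in> D" for d
    using s(2)[OF n(2)] that \<open>n > 0\<close> by auto
  let ?x = "a + (1 / real n) *\<^sub>R b"
  have "\<exists>c\<in>C. \<exists>d\<in>D. ?x - (c + (1 / real n) *\<^sub>R d) \<in> W"
  proof (rule ccontr)
    \<comment> \<open>Otherwise all genuine sums lie in the closed set of points \<open>y\<close> with \<open>?x - y\<close> outside
       \<open>W\<close>; then so does their limit \<open>?x\<close>, although \<open>?x - ?x = 0\<close> is in \<open>W\<close>.\<close>
    assume no_sum: "\<not> ?thesis"
    have "?x - ?x \<in> - W"
      using approx[OF \<open>n > 0\<close>]
    proof (rule closed_sum_image_mem_closed[where f = "\<lambda>y. ?x - y"])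
      show "continuous_on UNIV (\<lambda>y. ?x - y)"
        by (intro continuous_on_diff continuous_on_const continuous_on_id)
      show "closed (- W)" using W(1) by (rule closed_Compl)
    qed (use no_sum in blast)
    then show False using W(2) by simp
  qed
  then obtain c d where cd: "c \<in> C" "d \<in> D" and z: "?x - (c + (1 / real n) *\<^sub>R d) \<in> W"
    by blast
  have "a + (1 / real n) *\<^sub>R b - (1 / real n) *\<^sub>R d - (?x - (c + (1 / real n) *\<^sub>R d)) \<notin> C"
    using PQR PW n(1) d_small[OF cd(2)] z by blast
  then show False
    using cd(1) by simp
qed

text \<open>Write \<open>n v\<close> as \<open>c\<^sub>n + d\<^sub>n\<close> up to closure. Then \<open>c + v - c / n\<close> is the convex combination of
  \<open>c\<close> and \<open>c\<^sub>n\<close> with weights \<open>1 - 1 / n\<close> and \<open>1 / n\<close>, plus the vanishing error \<open>d\<^sub>n / n\<close>.\<close>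

lemma cone_directions_recede:
  fixes V C D :: "'a::real_tvs set"
  assumes "cone V" and "closed C" and "convex C" and "tvs_bounded D" and "V \<subseteq> C \<oplus>\<^sub>c D"
    and "c \<in> C" and "v \<in> V"
  shows "c + v \<in> C"
proof (rule limit_mem_closed[OF \<open>closed C\<close> \<open>tvs_bounded D\<close>])
  fix n :: nat assume n: "n > 0"
  let ?T = "C \<oplus>\<^sub>c (\<lambda>d. (1 / real n) *\<^sub>R d) ` D"
  let ?f = "\<lambda>x. (1 - 1 / real n) *\<^sub>R c + (1 / real n) *\<^sub>R x"
  have "real n *\<^sub>R v \<in> C \<oplus>\<^sub>c D"
    using assms(1,5,7) unfolding cone_def by auto
  then have "?f (real n *\<^sub>R v) \<in> ?T"
  proof (rule closed_sum_image_mem_closed)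
    show "continuous_on UNIV ?f"
      by (intro continuous_on_add continuous_on_const continuous_on_scaleR_tvs continuous_on_id)
    show "closed ?T" by (rule closed_closed_sum)
  next
    fix c' d assume "c' \<in> C" "d \<in> D"
    have "(1 - 1 / real n) *\<^sub>R c + (1 / real n) *\<^sub>R c' \<in> C"
      using n \<open>convex C\<close> \<open>c \<in> C\<close> \<open>c' \<in> C\<close> by (intro convexD) auto
    then have "((1 - 1 / real n) *\<^sub>R c + (1 / real n) *\<^sub>R c') + (1 / real n) *\<^sub>R d \<in> ?T"
      using \<open>d \<in> D\<close> by (intro add_mem_closed_sum) auto
    then show "?f (c' + d) \<in> ?T"
      by (simp add: scaleR_add_right add.assoc)
  qed
  moreover have "?f (real n *\<^sub>R v) = c + v + (1 / real n) *\<^sub>R (- c)"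
    using n by (simp add: algebra_simps)
  ultimately show "c + v + (1 / real n) *\<^sub>R (- c) \<in> ?T" by simp
qed

text \<open>Each further copy of \<open>a\<close> is absorbed by the current element of \<open>B\<close> at the price of one
  element of \<open>C\<close>. Convexity of \<open>C\<close> turns \<open>c'' + n c\<close> into \<open>(n + 1) m\<close> with \<open>m \<in> C\<close>, so the price
  stays a single dilate of \<open>C\<close> rather than an \<open>n\<close>-fold sum.\<close>

lemma multiple_add_mem_closed_sum:
  fixes B C :: "'a::real_tvs set"
  assumes "convex C" and "C \<noteq> {}" and step: "\<And>b. b \<in> B \<Longrightarrow> a + b \<in> B \<oplus>\<^sub>c C" and "b \<in> B"
  shows "real n *\<^sub>R a + b \<in> B \<oplus>\<^sub>c (\<lambda>c. real n *\<^sub>R c) ` C"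
proof (induction n)
  case 0
  obtain c where "c \<in> C" using \<open>C \<noteq> {}\<close> by blast
  then show ?case
    using add_mem_closed_sum[OF \<open>b \<in> B\<close>, of "0 *\<^sub>R c" "(\<lambda>c. 0 *\<^sub>R c) ` C"] by auto
next
  case (Suc n)
  let ?T = "B \<oplus>\<^sub>c (\<lambda>c. real (Suc n) *\<^sub>R c) ` C"
  have collect: "a + (b' + real n *\<^sub>R c) \<in> ?T" if "b' \<in> B" "c \<in> C" for b' c
  proof -
    have "(a + b') + real n *\<^sub>R c \<in> ?T"
      using step[OF \<open>b' \<in> B\<close>]
    proof (rule closed_sum_image_mem_closed[where f = "\<lambda>x. x + real n *\<^sub>R c"])
      show "continuous_on UNIV (\<lambda>x. x + real n *\<^sub>R c)"
        by (intro continuous_intros)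
      show "closed ?T" by (rule closed_closed_sum)
    next
      fix b'' c'' assume bc: "b'' \<in> B" "c'' \<in> C"
      let ?m = "(1 / real (Suc n)) *\<^sub>R c'' + (real n / real (Suc n)) *\<^sub>R c"
      have "?m \<in> C"
        using \<open>convex C\<close> bc(2) \<open>c \<in> C\<close> by (intro convexD) (auto simp: field_simps)
      then have "b'' + real (Suc n) *\<^sub>R ?m \<in> ?T"
        using bc(1) by (intro add_mem_closed_sum) auto
      moreover have "real (Suc n) *\<^sub>R ?m = c'' + real n *\<^sub>R c"
        by (simp add: scaleR_add_right del: of_nat_Suc)
      ultimately show "b'' + c'' + real n *\<^sub>R c \<in> ?T"
        by (simp add: add.assoc)
    qed
    then show ?thesis by (simp add: add.assoc)
  qed
  have "a + (real n *\<^sub>R a + b) \<in> ?T"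
    using Suc.IH
  proof (rule closed_sum_image_mem_closed[where f = "\<lambda>x. a + x"])
    show "continuous_on UNIV (\<lambda>x. a + x)"
      by (intro continuous_intros)
    show "closed ?T" by (rule closed_closed_sum)
  qed (use collect in auto)
  then show ?case by (simp add: algebra_simps)
qed

theorem theorem5p5:
  fixes V A B C :: "'a::real_tvs set"
  assumes "closed V" and "convex V" and "cone V" and "V \<noteq> {}"
    and "A \<in> closed_convex_sets_near V"
    and "B \<in> closed_convex_sets_near V"
    and "C \<in> closed_convex_sets_near V"
    and "A \<oplus>\<^sub>c B \<subseteq> B \<oplus>\<^sub>c C"
  shows "A \<subseteq> C"
proof
  fix a assume "a \<in> A"
  obtain D where D: "tvs_bounded D" "B \<subseteq> V \<oplus>\<^sub>c D" and "B \<noteq> {}"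
    using assms(6) unfolding closed_convex_sets_near_def closed_convex_sets_def
      bounded_closed_convex_sets_def by blast
  obtain E where E: "tvs_bounded E" "V \<subseteq> C \<oplus>\<^sub>c E" and C: "closed C" "convex C" "C \<noteq> {}"
    using assms(7) unfolding closed_convex_sets_near_def closed_convex_sets_def
      bounded_closed_convex_sets_def by blast
  obtain b where "b \<in> B" using \<open>B \<noteq> {}\<close> by blast
  have step: "a + b' \<in> B \<oplus>\<^sub>c C" if "b' \<in> B" for b'
    using add_mem_closed_sum[OF \<open>a \<in> A\<close> that] assms(8) by blast
  show "a \<in> C"
  proof (rule limit_mem_closed[OF C(1) D(1)])
    fix n :: nat assume n: "n > 0"
    let ?T = "C \<oplus>\<^sub>c (\<lambda>d. (1 / real n) *\<^sub>R d) ` D"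
    have split: "(1 / real n) *\<^sub>R b' + c \<in> ?T" if "b' \<in> B" "c \<in> C" for b' c
    proof (rule closed_sum_image_mem_closed[where f = "\<lambda>x. (1 / real n) *\<^sub>R x + c"])
      show "b' \<in> V \<oplus>\<^sub>c D" using D(2) \<open>b' \<in> B\<close> by blast
      show "continuous_on UNIV (\<lambda>x. (1 / real n) *\<^sub>R x + c)"
        by (intro continuous_on_add continuous_on_const continuous_on_scaleR_tvs continuous_on_id)
      show "closed ?T" by (rule closed_closed_sum)
    next
      fix v d assume "v \<in> V" "d \<in> D"
      have "(1 / real n) *\<^sub>R v \<in> V"
        using \<open>cone V\<close> \<open>v \<in> V\<close> unfolding cone_def by simp
      then have "c + (1 / real n) *\<^sub>R v \<in> C"
        using cone_directions_recede[OF \<open>cone V\<close> C(1,2) E] \<open>c \<in> C\<close> by blast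
      then have "(c + (1 / real n) *\<^sub>R v) + (1 / real n) *\<^sub>R d \<in> ?T"
        using \<open>d \<in> D\<close> by (intro add_mem_closed_sum) auto
      then show "(1 / real n) *\<^sub>R (v + d) + c \<in> ?T"
        by (simp add: algebra_simps)
    qed
    have "(1 / real n) *\<^sub>R (real n *\<^sub>R a + b) \<in> ?T"
      using multiple_add_mem_closed_sum[OF C(2,3) step \<open>b \<in> B\<close>]
    proof (rule closed_sum_image_mem_closed)
      show "continuous_on UNIV (\<lambda>x::'a. (1 / real n) *\<^sub>R x)"
        by (intro continuous_on_scaleR_tvs continuous_on_id)
      show "closed ?T" by (rule closed_closed_sum)
    next
      fix b' c assume "b' \<in> B" "c \<in> (\<lambda>c. real n *\<^sub>R c) ` C"
      then show "(1 / real n) *\<^sub>R (b' + c) \<in> ?T"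
        using split n by (auto simp: scaleR_add_right)
    qed
    then show "a + (1 / real n) *\<^sub>R b \<in> ?T"
      using n by (simp add: scaleR_add_right)
  qed
qed

end
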